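(* Let $(G_i)_{i\in I}$ be an infinite family of groups. If $\phi$ is a sentence of the first-order language of group theory such that $\prod_{i\in I}G_i\models\phi$, then there exist $q\neq r$ in $I$ such that $$G_r\times\prod_{i\in I\smallsetminus\{q\}}G_i\models\phi .$$
   Context: $\prod_{i\in I}G_i$ denotes the full (unrestricted) Cartesian product of the groups $G_i$. In the displayed group the factor $G_r$ occurs twice (once as the separate factor and once inside the product over $I\smallsetminus\{q\}$). *)

theory Defs
  imports "HOL-Algebra.Product_Groups"
begin

text \<open>
  First-order language of group theory, with equality, in the signature (multiplication, unit,
  inverse); variables are named by natural numbers.
\<close>

datatype gterm =
    Var nat
  | Unit
  | Mult gterm gterm
  | Inv gterm

datatype gform =
    Eq gterm gterm
  | Neg gform
  | Conj gform gform
  | Disj gform gform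
  | Impl gform gform
  | Forall nat gform
  | Exists nat gform

primrec term_vars :: "gterm \<Rightarrow> nat set" where
  "term_vars (Var n) = {n}"
| "term_vars Unit = {}"
| "term_vars (Mult s t) = term_vars s \<union> term_vars t"
| "term_vars (Inv t) = term_vars t"

primrec free_vars :: "gform \<Rightarrow> nat set" where
  "free_vars (Eq s t) = term_vars s \<union> term_vars t"
| "free_vars (Neg \<phi>) = free_vars \<phi>"
| "free_vars (Conj \<phi> \<psi>) = free_vars \<phi> \<union> free_vars \<psi>"
| "free_vars (Disj \<phi> \<psi>) = free_vars \<phi> \<union> free_vars \<psi>"
| "free_vars (Impl \<phi> \<psi>) = free_vars \<phi> \<union> free_vars \<psi>"
| "free_vars (Forall n \<phi>) = free_vars \<phi> - {n}"
| "free_vars (Exists n \<phi>) = free_vars \<phi> - {n}"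

definition sentence :: "gform \<Rightarrow> bool" where
  "sentence \<phi> \<longleftrightarrow> free_vars \<phi> = {}"

primrec term_val :: "('a, 'b) monoid_scheme \<Rightarrow> (nat \<Rightarrow> 'a) \<Rightarrow> gterm \<Rightarrow> 'a" where
  "term_val G e (Var n) = e n"
| "term_val G e Unit = \<one>\<^bsub>G\<^esub>"
| "term_val G e (Mult s t) = term_val G e s \<otimes>\<^bsub>G\<^esub> term_val G e t"
| "term_val G e (Inv t) = inv\<^bsub>G\<^esub> (term_val G e t)"

primrec sat :: "('a, 'b) monoid_scheme \<Rightarrow> (nat \<Rightarrow> 'a) \<Rightarrow> gform \<Rightarrow> bool" where
  "sat G e (Eq s t) \<longleftrightarrow> term_val G e s = term_val G e t"
| "sat G e (Neg \<phi>) \<longleftrightarrow> \<not> sat G e \<phi>"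
| "sat G e (Conj \<phi> \<psi>) \<longleftrightarrow> sat G e \<phi> \<and> sat G e \<psi>"
| "sat G e (Disj \<phi> \<psi>) \<longleftrightarrow> sat G e \<phi> \<or> sat G e \<psi>"
| "sat G e (Impl \<phi> \<psi>) \<longleftrightarrow> (sat G e \<phi> \<longrightarrow> sat G e \<psi>)"
| "sat G e (Forall n \<phi>) \<longleftrightarrow> (\<forall>x\<in>carrier G. sat G (e(n := x)) \<phi>)"
| "sat G e (Exists n \<phi>) \<longleftrightarrow> (\<exists>x\<in>carrier G. sat G (e(n := x)) \<phi>)"

text \<open>
  Used only for sentences, whose truth value does not depend on the assignment; the carrier of a
  group is nonempty, so quantifying over all assignments into it is not vacuous.
\<close>

definition models :: "('a, 'b) monoid_scheme \<Rightarrow> gform \<Rightarrow> bool" (infix "\<Turnstile>" 50) where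
  "G \<Turnstile> \<phi> \<longleftrightarrow> (\<forall>e. range e \<subseteq> carrier G \<longrightarrow> sat G e \<phi>)"

end

theory Submission
  imports Defs "HOL-Library.Nat_Bijection"
begin

text \<open>
  The theorem is a pigeonhole argument on Ehrenfeucht-Fraisse types. To a group \<open>A\<close> with an
  assignment one attaches a finite object, its type relative to \<open>\<phi>\<close>, that records how the
  quantifiers of \<open>\<phi>\<close> can be played out in \<open>A\<close> and what the equations of \<open>\<phi>\<close> say at the end of each
  play. Two facts about it carry the proof.

  The number of types is finite (\<open>finite_ef_types\<close>): there are two for an equation, and if \<open>\<phi>\<close> has
  \<open>m\<close> types then quantifying \<open>\<phi>\<close> gives at most \<open>2^m\<close>, since the type of a quantified formula
  is a set of types of \<open>\<phi>\<close>.

  The truth of \<open>\<phi>\<close> in \<open>A \<times>\<times> B\<close> depends on \<open>A\<close> only through its type (\<open>sat_DirProd_cong\<close>): an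
  equation holds in the product iff it holds in both coordinates, and an element \<open>(x, y)\<close> chosen
  by a quantifier is answered by \<open>(x', y)\<close>, where \<open>x'\<close> is supplied by the equality of types.

  As \<open>I\<close> is infinite, some \<open>q \<noteq> r\<close> have factors of the same type. Splitting off the factor at \<open>q\<close>
  (\<open>iso_product_group_split\<close>) writes the product as \<open>G q \<times>\<times> B\<close> with \<open>B\<close> the product over the
  other indices, and there \<open>G r\<close> can replace \<open>G q\<close> without changing the truth of \<open>\<phi>\<close>.
\<close>

section \<open>Types relative to a formula\<close>

text \<open>
  The type follows the formula itself instead of its quantifier rank: with function symbols there
  are infinitely many atomic formulas in finitely many variables, so types of bounded rank would
  not be finite in number, whereas a single formula contains only finitely many equations. A
  connective keeps the types of its parts rather than their truth values, because the truth value
  of a formula in one factor does not determine its truth in the product. Hereditarily finite sets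
  are coded as natural numbers in order that all types live in one HOL type; \<open>set_encode\<close> is
  faithful on finite sets only, so the coding makes sense in view of \<open>finite_ef_types\<close>.
\<close>

primrec ef_type :: "('a, 'b) monoid_scheme \<Rightarrow> (nat \<Rightarrow> 'a) \<Rightarrow> gform \<Rightarrow> nat" where
  "ef_type A e (Eq s t) = of_bool (term_val A e s = term_val A e t)"
| "ef_type A e (Neg \<phi>) = ef_type A e \<phi>"
| "ef_type A e (Conj \<phi> \<psi>) = prod_encode (ef_type A e \<phi>, ef_type A e \<psi>)"
| "ef_type A e (Disj \<phi> \<psi>) = prod_encode (ef_type A e \<phi>, ef_type A e \<psi>)"
| "ef_type A e (Impl \<phi> \<psi>) = prod_encode (ef_type A e \<phi>, ef_type A e \<psi>)"
| "ef_type A e (Forall n \<phi>) = set_encode ((\<lambda>x. ef_type A (e(n := x)) \<phi>) ` carrier A)"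
| "ef_type A e (Exists n \<phi>) = set_encode ((\<lambda>x. ef_type A (e(n := x)) \<phi>) ` carrier A)"

text \<open>
  The bound is uniform over all structures on the given carrier type and all assignments. This
  uniformity is what makes the induction pass through a quantifier, where the assignment varies.
\<close>

lemma finite_ef_types:
  "finite (range (\<lambda>(A :: ('a, 'b) monoid_scheme, e). ef_type A e \<phi>))"
proof (induction \<phi>)
  case (Eq s t)
  show ?case
    by (rule finite_subset[where B = "{0, 1}"]) auto
next
  case (Neg \<phi>)
  then show ?case by simp
next
  case (Conj \<phi> \<psi>)
  show ?case
    by (rule finite_subset[OF _ finite_imageI[OF finite_cartesian_product[OF Conj.IH],
          of prod_encode]]) force
next
  case (Disj \<phi> \<psi>)
  show ?case
    by (rule finite_subset[OF _ finite_imageI[OF finite_cartesian_product[OF Disj.IH],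
          of prod_encode]]) force
next
  case (Impl \<phi> \<psi>)
  show ?case
    by (rule finite_subset[OF _ finite_imageI[OF finite_cartesian_product[OF Impl.IH],
          of prod_encode]]) force
next
  case (Forall n \<phi>)
  have "finite (set_encode ` Pow (range (\<lambda>(A :: ('a, 'b) monoid_scheme, e). ef_type A e \<phi>)))"
    using Forall.IH by simp
  then show ?case
    by (rule finite_subset[rotated]) (force intro!: imageI)
next
  case (Exists n \<phi>)
  have "finite (set_encode ` Pow (range (\<lambda>(A :: ('a, 'b) monoid_scheme, e). ef_type A e \<phi>)))"
    using Exists.IH by simp
  then show ?case
    by (rule finite_subset[rotated]) (force intro!: imageI)
qed

lemma finite_image_ef_type: "finite ((\<lambda>x. ef_type A (d x) \<phi>) ` X)"
  by (rule finite_subset[OF _ finite_ef_types[of \<phi>]]) force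

text \<open>
  Equality of the codes of two quantified formulas is the back-and-forth condition: each choice of
  an element on one side is matched on the other side by a choice with the same type.
\<close>

lemma ef_type_image_eq:
  assumes "set_encode ((\<lambda>x. ef_type A (d x) \<phi>) ` X)
         = set_encode ((\<lambda>x. ef_type A' (d' x) \<phi>) ` X')"
  shows "(\<lambda>x. ef_type A (d x) \<phi>) ` X = (\<lambda>x. ef_type A' (d' x) \<phi>) ` X'"
  using assms by (simp only: set_encode_eq finite_image_ef_type)

section \<open>Satisfaction in a direct product\<close>

lemma term_val_closed:
  assumes "group G" "range e \<subseteq> carrier G"
  shows "term_val G e t \<in> carrier G"
proof -
  interpret group G by fact
  show ?thesis using assms(2) by (induction t) auto
qed

lemma term_val_DirProd:
  assumes "group A" "group B" "range e \<subseteq> carrier A" "range f \<subseteq> carrier B"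
  shows "term_val (A \<times>\<times> B) (\<lambda>k. (e k, f k)) t = (term_val A e t, term_val B f t)"
  by (induction t) (use assms in \<open>simp_all add: inv_DirProd term_val_closed\<close>)

lemma same_image_quantifiers:
  assumes "f ` X = g ` Y"
    and "\<And>x y. x \<in> X \<Longrightarrow> y \<in> Y \<Longrightarrow> f x = g y \<Longrightarrow> P x \<longleftrightarrow> Q y"
  shows "(\<forall>x\<in>X. P x) \<longleftrightarrow> (\<forall>y\<in>Y. Q y)"
    and "(\<exists>x\<in>X. P x) \<longleftrightarrow> (\<exists>y\<in>Y. Q y)"
proof -
  have "\<forall>x\<in>X. \<exists>y\<in>Y. P x \<longleftrightarrow> Q y" "\<forall>y\<in>Y. \<exists>x\<in>X. P x \<longleftrightarrow> Q y"
    using assms by (metis (no_types, lifting) imageE imageI)+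
  then show "(\<forall>x\<in>X. P x) \<longleftrightarrow> (\<forall>y\<in>Y. Q y)" "(\<exists>x\<in>X. P x) \<longleftrightarrow> (\<exists>y\<in>Y. Q y)"
    by blast+
qed

lemma range_fun_upd_subset:
  "range e \<subseteq> C \<Longrightarrow> x \<in> C \<Longrightarrow> range (e(n := x)) \<subseteq> C"
  by auto

lemma fun_upd_Pair:
  "(\<lambda>k. (e k, f k))(n := (x, y)) = (\<lambda>k. ((e(n := x)) k, (f(n := y)) k))"
  by auto

text \<open>
  The factor \<open>B\<close> and its assignment are the same on both sides, so only the first coordinates have
  to be matched. Generalising over the assignment \<open>f\<close> is essential, since a quantifier over the
  product extends both coordinates at once.
\<close>

lemma sat_DirProd_cong:
  assumes "group A" "group A'" "group B"
    and "range e \<subseteq> carrier A" "range e' \<subseteq> carrier A'" "range f \<subseteq> carrier B"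
    and "ef_type A e \<phi> = ef_type A' e' \<phi>"
  shows "sat (A \<times>\<times> B) (\<lambda>k. (e k, f k)) \<phi> \<longleftrightarrow> sat (A' \<times>\<times> B) (\<lambda>k. (e' k, f k)) \<phi>"
  using assms(4-7)
proof (induction \<phi> arbitrary: e e' f)
  case (Eq s t)
  then show ?case
    using assms(1-3) by (simp add: term_val_DirProd of_bool_def split: if_splits)
next
  case (Neg \<phi>)
  then show ?case by simp
next
  case (Conj \<phi> \<psi>)
  then show ?case by simp
next
  case (Disj \<phi> \<psi>)
  then show ?case by simp
next
  case (Impl \<phi> \<psi>)
  then show ?case by simp
next
  case (Forall n \<phi>)
  have types: "(\<lambda>x. ef_type A (e(n := x)) \<phi>) ` carrier A
      = (\<lambda>x. ef_type A' (e'(n := x)) \<phi>) ` carrier A'"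
    using Forall.prems(4) by (intro ef_type_image_eq) simp
  have step: "sat (A \<times>\<times> B) (\<lambda>k. ((e(n := x)) k, (f(n := y)) k)) \<phi>
          \<longleftrightarrow> sat (A' \<times>\<times> B) (\<lambda>k. ((e'(n := x')) k, (f(n := y)) k)) \<phi>"
    if "x \<in> carrier A" "x' \<in> carrier A'" "y \<in> carrier B"
      "ef_type A (e(n := x)) \<phi> = ef_type A' (e'(n := x')) \<phi>" for x x' y
    by (intro Forall.IH[of "e(n := x)" "e'(n := x')" "f(n := y)"] range_fun_upd_subset
          Forall.prems(1-3) that)
  have "(\<forall>x\<in>carrier A. \<forall>y\<in>carrier B.
        sat (A \<times>\<times> B) (\<lambda>k. ((e(n := x)) k, (f(n := y)) k)) \<phi>)
    \<longleftrightarrow> (\<forall>x\<in>carrier A'. \<forall>y\<in>carrier B.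
        sat (A' \<times>\<times> B) (\<lambda>k. ((e'(n := x)) k, (f(n := y)) k)) \<phi>)"
    by (rule same_image_quantifiers(1)[OF types]) (intro ball_cong refl step)
  then show ?case
    by (simp add: fun_upd_Pair)
next
  case (Exists n \<phi>)
  have types: "(\<lambda>x. ef_type A (e(n := x)) \<phi>) ` carrier A
      = (\<lambda>x. ef_type A' (e'(n := x)) \<phi>) ` carrier A'"
    using Exists.prems(4) by (intro ef_type_image_eq) simp
  have step: "sat (A \<times>\<times> B) (\<lambda>k. ((e(n := x)) k, (f(n := y)) k)) \<phi>
          \<longleftrightarrow> sat (A' \<times>\<times> B) (\<lambda>k. ((e'(n := x')) k, (f(n := y)) k)) \<phi>"
    if "x \<in> carrier A" "x' \<in> carrier A'" "y \<in> carrier B"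
      "ef_type A (e(n := x)) \<phi> = ef_type A' (e'(n := x')) \<phi>" for x x' y
    by (intro Exists.IH[of "e(n := x)" "e'(n := x')" "f(n := y)"] range_fun_upd_subset
          Exists.prems(1-3) that)
  have "(\<exists>x\<in>carrier A. \<exists>y\<in>carrier B.
        sat (A \<times>\<times> B) (\<lambda>k. ((e(n := x)) k, (f(n := y)) k)) \<phi>)
    \<longleftrightarrow> (\<exists>x\<in>carrier A'. \<exists>y\<in>carrier B.
        sat (A' \<times>\<times> B) (\<lambda>k. ((e'(n := x)) k, (f(n := y)) k)) \<phi>)"
    by (rule same_image_quantifiers(2)[OF types]) (intro bex_cong refl step)
  then show ?case
    by (simp add: fun_upd_Pair)
qed

section \<open>Sentences, and invariance under isomorphism\<close>

lemma term_val_cong: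
  "(\<And>k. k \<in> term_vars t \<Longrightarrow> e k = e' k) \<Longrightarrow> term_val G e t = term_val G e' t"
  by (induction t) auto

lemma sat_cong:
  "(\<And>k. k \<in> free_vars \<phi> \<Longrightarrow> e k = e' k) \<Longrightarrow> sat G e \<phi> \<longleftrightarrow> sat G e' \<phi>"
proof (induction \<phi> arbitrary: e e')
  case (Eq s t)
  then show ?case using term_val_cong[of s e e' G] term_val_cong[of t e e' G] by simp
next
  case (Neg \<phi>)
  from Neg.IH[of e e'] Neg.prems show ?case by simp
next
  case (Conj \<phi> \<psi>)
  from Conj.IH[of e e'] Conj.prems show ?case by simp
next
  case (Disj \<phi> \<psi>)
  from Disj.IH[of e e'] Disj.prems show ?case by simp
next
  case (Impl \<phi> \<psi>)
  from Impl.IH[of e e'] Impl.prems show ?case by simp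
next
  case (Forall n \<phi>)
  have "sat G (e(n := x)) \<phi> \<longleftrightarrow> sat G (e'(n := x)) \<phi>" for x
    by (rule Forall.IH) (use Forall.prems in auto)
  then show ?case by simp
next
  case (Exists n \<phi>)
  have "sat G (e(n := x)) \<phi> \<longleftrightarrow> sat G (e'(n := x)) \<phi>" for x
    by (rule Exists.IH) (use Exists.prems in auto)
  then show ?case by simp
qed

text \<open>
  One assignment decides a sentence. The types of different groups can therefore be compared at
  the constant assignments with value the unit.
\<close>

lemma models_iff_sat:
  assumes "sentence \<phi>" "range e \<subseteq> carrier G"
  shows "G \<Turnstile> \<phi> \<longleftrightarrow> sat G e \<phi>"
  using assms sat_cong[of \<phi> _ e G] unfolding models_def sentence_def by blast

lemma term_val_iso:
  assumes "group G" "group H" "h \<in> hom G H" "range e \<subseteq> carrier G"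
  shows "term_val H (h \<circ> e) t = h (term_val G e t)"
proof -
  interpret group_hom G H h
    using assms by (simp add: group_hom_def group_hom_axioms_def)
  show ?thesis
    by (induction t) (use assms in \<open>simp_all add: term_val_closed\<close>)
qed

lemma sat_iso:
  assumes "group G" "group H" "h \<in> iso G H" "range e \<subseteq> carrier G"
  shows "sat H (h \<circ> e) \<phi> \<longleftrightarrow> sat G e \<phi>"
  using assms(4)
proof (induction \<phi> arbitrary: e)
  case (Eq s t)
  have "inj_on h (carrier G)" "h \<in> hom G H"
    using assms(3) by (auto simp: iso_def bij_betw_def)
  moreover from this have "term_val H (h \<circ> e) u = h (term_val G e u)" for u
    using term_val_iso assms(1,2) Eq by blast
  moreover have "term_val G e u \<in> carrier G" for u
    using term_val_closed assms(1) Eq by blast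
  ultimately show ?case
    by (simp only: sat.simps inj_on_eq_iff)
next
  case (Forall n \<phi>)
  have "carrier H = h ` carrier G"
    using assms(3) by (auto simp: iso_def bij_betw_def)
  moreover have "sat H ((h \<circ> e)(n := h x)) \<phi> \<longleftrightarrow> sat G (e(n := x)) \<phi>" if "x \<in> carrier G" for x
    using Forall.IH[OF range_fun_upd_subset[OF Forall.prems that]] by (simp only: fun_upd_comp)
  ultimately show ?case
    by (simp only: sat.simps ball_simps bex_simps cong: ball_cong bex_cong)
next
  case (Exists n \<phi>)
  have "carrier H = h ` carrier G"
    using assms(3) by (auto simp: iso_def bij_betw_def)
  moreover have "sat H ((h \<circ> e)(n := h x)) \<phi> \<longleftrightarrow> sat G (e(n := x)) \<phi>" if "x \<in> carrier G" for x
    using Exists.IH[OF range_fun_upd_subset[OF Exists.prems that]] by (simp only: fun_upd_comp)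
  ultimately show ?case
    by (simp only: sat.simps ball_simps bex_simps cong: ball_cong bex_cong)
qed auto

lemma models_iso:
  assumes "group G" "group H" "h \<in> iso G H" "sentence \<phi>"
  shows "G \<Turnstile> \<phi> \<longleftrightarrow> H \<Turnstile> \<phi>"
proof -
  have e: "range (\<lambda>k::nat. \<one>\<^bsub>G\<^esub>) \<subseteq> carrier G"
    using assms(1) by (auto simp: group.is_monoid)
  moreover have "range (h \<circ> (\<lambda>k::nat. \<one>\<^bsub>G\<^esub>)) \<subseteq> carrier H"
    using assms(3) e by (auto simp: iso_def bij_betw_def)
  ultimately show ?thesis
    using assms models_iff_sat sat_iso by metis
qed

section \<open>Exchanging one factor of an infinite product\<close>

lemma iso_product_group_split:
  assumes "q \<in> I"
  shows "(\<lambda>f. (f q, restrict f (I - {q})))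
           \<in> iso (product_group I G) (G q \<times>\<times> product_group (I - {q}) G)"
    (is "?split \<in> iso ?P ?Q")
proof -
  have "bij_betw ?split (carrier ?P) (carrier ?Q)"
  proof (rule bij_betw_byWitness[where f' = "\<lambda>(x, f). f(q := x)"])
    show "\<forall>f\<in>carrier ?P. (\<lambda>(x, f). f(q := x)) (?split f) = f"
      by (auto simp: fun_eq_iff PiE_iff extensional_def)
    show "\<forall>p\<in>carrier ?Q. ?split ((\<lambda>(x, f). f(q := x)) p) = p"
      by (auto simp: fun_eq_iff PiE_iff extensional_def)
    show "?split ` carrier ?P \<subseteq> carrier ?Q"
      using assms by (auto simp: PiE_iff split: if_splits)
    show "(\<lambda>(x, f). f(q := x)) ` carrier ?Q \<subseteq> carrier ?P"
      using assms PiE_fun_upd[of _ "\<lambda>i. carrier (G i)" q _ "I - {q}"] by (auto simp: insert_absorb)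
  qed
  moreover have "?split (f \<otimes>\<^bsub>?P\<^esub> g) = ?split f \<otimes>\<^bsub>?Q\<^esub> ?split g" for f g
    using assms by (auto simp: restrict_def)
  ultimately show ?thesis
    by (auto simp only: iso_def hom_def bij_betw_def)
qed

theorem proposition1p2:
  fixes I :: "'i set"
    and G :: "'i \<Rightarrow> ('a, 'b) monoid_scheme"
    and \<phi> :: gform
  assumes "infinite I"
    and "\<And>i. i \<in> I \<Longrightarrow> group (G i)"
    and "sentence \<phi>"
    and "product_group I G \<Turnstile> \<phi>"
  shows "\<exists>q\<in>I. \<exists>r\<in>I. q \<noteq> r \<and> (G r \<times>\<times> product_group (I - {q}) G) \<Turnstile> \<phi>"
proof -
  \<comment> \<open>Finitely many types, infinitely many indices: two factors have the same type.\<close>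
  let ?type = "\<lambda>i. ef_type (G i) (\<lambda>_. \<one>\<^bsub>G i\<^esub>) \<phi>"
  have "finite (?type ` I)"
    by (rule finite_subset[OF _ finite_ef_types[of \<phi>]]) force
  then have "\<not> inj_on ?type I"
    using \<open>infinite I\<close> finite_imageD by blast
  then obtain q r where qr: "q \<in> I" "r \<in> I" "q \<noteq> r" "?type q = ?type r"
    unfolding inj_on_def by metis
  let ?B = "product_group (I - {q}) G"
  have groups: "group (G q)" "group (G r)" "group ?B" "group (product_group I G)"
    using qr assms(2) by (blast intro: product_group)+
  have ones: "range (\<lambda>_::nat. \<one>\<^bsub>H\<^esub>) \<subseteq> carrier H" if "group H" for H :: "('x, 'y) monoid_scheme"
    using that by (auto simp: group.is_monoid)
  have "G q \<times>\<times> ?B \<Turnstile> \<phi>"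
    using models_iso[OF groups(4) DirProd_group[OF groups(1,3)]
        iso_product_group_split[OF qr(1)] assms(3)] assms(4) by simp
  then have "sat (G q \<times>\<times> ?B) (\<lambda>_. (\<one>\<^bsub>G q\<^esub>, \<one>\<^bsub>?B\<^esub>)) \<phi>"
    using models_iff_sat[OF assms(3) ones[OF DirProd_group[OF groups(1,3)]]] by simp
  then have "sat (G r \<times>\<times> ?B) (\<lambda>_. (\<one>\<^bsub>G r\<^esub>, \<one>\<^bsub>?B\<^esub>)) \<phi>"
    using sat_DirProd_cong[OF groups(1-3) ones ones ones qr(4)] groups by simp
  then have "G r \<times>\<times> ?B \<Turnstile> \<phi>"
    using models_iff_sat[OF assms(3) ones[OF DirProd_group[OF groups(2,3)]]] by simp
  with qr show ?thesis by blast
qed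

end
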